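(* For all integers $m,n\geq 0$, the double sum $$S(m,n):=\sum_{i=0}^{m}\frac{(-m)_{i}\,(n+1)_{i}}{i!\,(m+n+2)_{i}}\sum_{j=0}^{n}\frac{(-n)_{j}\left(\frac{1}{2}-n\right)_{j}}{j!\,\left(\frac{1}{2}\right)_{j}}\cdot\frac{1}{i+j+\frac{1}{2}}$$ satisfies $$S(m,n)=2^{2m+2n}\,\frac{m!\,(m+n)!\,(m+n+1)!\,\left(\frac{1}{2}\right)_{n}}{n!\,(n+2m+1)!\,\left(\frac{1}{2}\right)_{m+n+1}}.$$
   Context: The Pochhammer symbol is defined for $t\in\mathbb{C}$ and integers $k\geq 0$ by $(t)_0=1$ and $(t)_{k+1}=(t)_k\,(t+k)$. *)

theory Defs
  imports Complex_Main
begin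

definition S :: "nat \<Rightarrow> nat \<Rightarrow> complex" where
  "S m n =
    (\<Sum>i = 0..m.
      pochhammer (- of_nat m) i * pochhammer (of_nat n + 1) i
        / (fact i * pochhammer (of_nat m + of_nat n + 2) i)
      * (\<Sum>j = 0..n.
          pochhammer (- of_nat n) j * pochhammer (1 / 2 - of_nat n) j
            / (fact j * pochhammer (1 / 2) j)
          * (1 / (of_nat i + of_nat j + 1 / 2))))"

end

theory Submission
  imports Defs "HOL-Computational_Algebra.Formal_Power_Series"
begin

text \<open>
  Expanding the outer hypergeometric polynomial around \<open>1\<close> instead of \<open>0\<close> turns the weights
  \<open>1 / (i + j + 1/2)\<close> into reciprocals of Pochhammer symbols, after which the sum over \<open>j\<close> is a
  Chu-Vandermonde sum. What remains is the terminating series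
  \<open>3F2(-m, 2n + 1, 1; -2m, n + 3/2; 1)\<close>, an instance of Watson's theorem that is evaluated by
  telescoping a recurrence in \<open>m\<close>.
\<close>

section \<open>Pochhammer symbols at half-integers and integers\<close>

lemma pochhammer_add_half_nonzero:
  fixes n k :: nat
  shows "pochhammer (of_nat n + 1/2 :: complex) k \<noteq> 0"
    "pochhammer (of_nat n + 3/2 :: complex) k \<noteq> 0"
    "pochhammer (1/2 :: complex) k \<noteq> 0"
proof -
  have *: "pochhammer (of_real x :: complex) k \<noteq> 0" if "x > 0" for x :: real
    using pochhammer_pos[OF that, of k] by (simp add: pochhammer_of_real)
  show "pochhammer (of_nat n + 1/2 :: complex) k \<noteq> 0" using *[of "real n + 1/2"] by simp
  show "pochhammer (of_nat n + 3/2 :: complex) k \<noteq> 0" using *[of "real n + 3/2"] by simp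
  show "pochhammer (1/2 :: complex) k \<noteq> 0" using *[of "1/2"] by simp
qed

lemma pochhammer_of_nat_Suc:
  "pochhammer (of_nat n + 1 :: 'a :: field_char_0) k = fact (n + k) / fact n"
  using pochhammer_product'[of "1 :: 'a" n k]
  by (simp add: pochhammer_fact[symmetric] add.commute field_simps)

lemma pochhammer_neg_of_nat:
  assumes "k \<le> n"
  shows "pochhammer (- of_nat n :: 'a :: field_char_0) k = (-1) ^ k * fact n / fact (n - k)"
  using assms pochhammer_of_nat_Suc[of "n - k" k, where 'a = 'a]
  by (simp add: pochhammer_minus of_nat_diff)

section \<open>Partial fractions, change of basis and the inner Vandermonde sum\<close>

text \<open>Writing \<open>1 / (i + z)\<close> as
  \<open>pochhammer z i / (z * pochhammer (z + 1) i)\<close> gives a Chu-Vandermonde sum; for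
  positive real \<open>z\<close> it is the beta integral of \<open>x^(z-1) * (1-x)^k\<close> over
  [0,1]. The upper limit \<open>m\<close> adds only zero terms to \<open>k\<close> and makes the
  range independent of \<open>k\<close>, as needed for interchanging sums.\<close>

lemma partial_fraction_pochhammer:
  fixes z :: "'a :: field_char_0"
  assumes z: "\<And>i. z + of_nat i \<noteq> 0" and "k \<le> m"
  shows "(\<Sum>i = 0..m. pochhammer (- of_nat k) i / fact i * (1 / (of_nat i + z)))
    = fact k / pochhammer z (k + 1)"
proof -
  have z1: "z + 1 \<noteq> - of_nat j" for j
    using z[of "Suc j"] by (simp add: eq_neg_iff_add_eq_0 add.assoc)
  have nz: "pochhammer (z + 1) i \<noteq> 0" for i
    using z1 by (auto simp: pochhammer_eq_0_iff)
  have z0: "z \<noteq> 0" using z[of 0] by simp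
  have "(\<Sum>i = 0..m. pochhammer (- of_nat k) i / fact i * (1 / (of_nat i + z)))
      = (\<Sum>i = 0..k. pochhammer (- of_nat k) i / fact i * (1 / (of_nat i + z)))"
    using \<open>k \<le> m\<close> by (intro sum.mono_neutral_right) (auto simp: pochhammer_of_nat_eq_0_lemma)
  also have "\<dots> = (\<Sum>i = 0..k. pochhammer z i * pochhammer (- of_nat k) i
      / (of_nat (fact i) * pochhammer (z + 1) i)) / z"
    unfolding sum_divide_distrib
  proof (rule sum.cong[OF refl])
    fix i
    have "pochhammer z i * (z + of_nat i) = z * pochhammer (z + 1) i"
      using pochhammer_Suc[of z i] pochhammer_rec[of z i] by simp
    then have "pochhammer z i = z * pochhammer (z + 1) i / (of_nat i + z)"
      using z[of i] by (simp add: field_simps)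
    then show "pochhammer (- of_nat k) i / fact i * (1 / (of_nat i + z))
      = pochhammer z i * pochhammer (- of_nat k) i / (of_nat (fact i) * pochhammer (z + 1) i) / z"
      using nz[of i] z0 by simp
  qed
  also have "\<dots> = pochhammer 1 k / pochhammer (z + 1) k / z"
    using z1 by (subst Vandermonde_pochhammer) auto
  also have "\<dots> = fact k / pochhammer z (k + 1)"
    by (simp add: pochhammer_rec pochhammer_fact)
  finally show ?thesis .
qed

text \<open>Since \<open>pochhammer (- of_nat k) i / fact i\<close> is the \<open>i\<close>-th coefficient of \<open>(1 - x)^k\<close>, this is the
  change of basis from powers of \<open>x\<close> to powers of \<open>1 - x\<close>.\<close>

lemma outer_coeff_expansion:
  fixes m n i :: nat
  assumes "i \<le> m"
  shows "pochhammer (- of_nat m) i * pochhammer (of_nat n + 1) i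
      / (fact i * pochhammer (of_nat m + of_nat n + 2) i)
    = pochhammer (of_nat m + 1) m / pochhammer (of_nat m + of_nat n + 2) m
      * (\<Sum>k = 0..m. pochhammer (- of_nat m) k * pochhammer (of_nat n + 1) k
          / (fact k * pochhammer (- of_nat (2 * m)) k)
          * (pochhammer (- of_nat k) i / fact i :: complex))"
proof -
  define l where "l = m - i"
  have m: "m = i + l" using assms by (simp add: l_def)
  let ?d = "\<lambda>k. pochhammer (- of_nat m) k * pochhammer (of_nat n + 1) k
          / (fact k * pochhammer (- of_nat (2 * m)) k)
          * (pochhammer (- of_nat k) i / fact i :: complex)"
  \<comment> \<open>\<open>?A\<close> is the first surviving term \<open>?d i\<close>: for
    \<open>k < i\<close> the factor \<open>pochhammer (- of_nat k) i\<close> vanishes. Pulling it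
    out leaves a hypergeometric sum in \<open>h = k - i\<close>.\<close>
  let ?A = "pochhammer (- of_nat m) i * pochhammer (of_nat n + 1) i
      / pochhammer (- of_nat (2 * m)) i * ((-1) ^ i / fact i) :: complex"
  have "(\<Sum>k = 0..m. ?d k) = (\<Sum>k = i..i + l. ?d k)"
    using assms unfolding m[symmetric]
    by (intro sum.mono_neutral_right) (auto simp: pochhammer_of_nat_eq_0_lemma)
  also have "\<dots> = (\<Sum>h = 0..l. ?d (h + i))"
    using sum.shift_bounds_cl_nat_ivl[of ?d 0 i l] by (simp add: add.commute)
  also have "\<dots> = (\<Sum>h = 0..l. ?A * (pochhammer (of_nat n + 1 + of_nat i) h * pochhammer (- of_nat l) h
      / (of_nat (fact h) * pochhammer (- of_nat (2 * m) + of_nat i) h)))"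
  proof (rule sum.cong[OF refl])
    fix h assume "h \<in> {0..l}"
    have 1: "pochhammer (- of_nat (h + i) :: complex) i = (-1) ^ i * fact (h + i) / fact h"
      by (subst pochhammer_neg_of_nat) auto
    have 2: "- of_nat m + of_nat i = (- of_nat l :: complex)" by (simp add: m)
    show "?d (h + i) = ?A * (pochhammer (of_nat n + 1 + of_nat i) h * pochhammer (- of_nat l) h
      / (of_nat (fact h) * pochhammer (- of_nat (2 * m) + of_nat i) h))"
      unfolding 1 unfolding add.commute[of h i] pochhammer_product' 2
      by (simp add: mult_ac)
  qed
  \<comment> \<open>Chu-Vandermonde with upper parameters \<open>-l\<close>,
    \<open>n + 1 + i\<close> and lower parameter \<open>-2m + i\<close>; \<open>i\<close> drops out
    of the difference. As the lower parameter can be a nonpositive integer, it must be checked that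
    no factor before index \<open>l\<close> is zero.\<close>
  also have "\<dots> = ?A * (pochhammer (- of_nat (2 * m) - of_nat n - 1) l
      / pochhammer (- of_nat (2 * m) + of_nat i) l)"
  proof -
    have "- of_nat (2 * m) + of_nat i \<noteq> (- of_nat j :: complex)" if "j < l" for j
    proof
      assume "- of_nat (2 * m) + of_nat i = (- of_nat j :: complex)"
      then have "of_nat (i + j) = (of_nat (2 * m) :: complex)" by (simp add: algebra_simps)
      then have "i + j = 2 * m" unfolding of_nat_eq_iff .
      with that m show False by simp
    qed
    moreover have c: "- of_nat (2 * m) - of_nat n - 1
        = - of_nat (2 * m) + of_nat i - (of_nat n + 1 + of_nat i :: complex)"
      by simp
    ultimately show ?thesis
      unfolding sum_distrib_left[symmetric] c by (subst Vandermonde_pochhammer) auto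
  qed
  also have "\<dots> = pochhammer (- of_nat m) i * pochhammer (of_nat n + 1) i * ((-1) ^ i / fact i)
      * pochhammer (- of_nat (2 * m) - of_nat n - 1) l / pochhammer (- of_nat (2 * m)) m"
    using pochhammer_product'[of "- of_nat (2 * m) :: complex" i l] by (simp add: m[symmetric])
  also have "pochhammer (- of_nat (2 * m) :: complex) m = (-1) ^ m * pochhammer (of_nat m + 1) m"
    by (simp add: pochhammer_minus)
  \<comment> \<open>Reversing the factors gives the parameter
    \<open>(2m + n + 1) - l + 1 = m + n + 2 + i\<close>, because \<open>l = m - i\<close>. This is
    the tail that extends \<open>pochhammer (m + n + 2) i\<close> to length \<open>m\<close>, so it
    cancels against the constant in front.\<close>
  also have "pochhammer (- of_nat (2 * m) - of_nat n - 1 :: complex) l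
      = (-1) ^ l * pochhammer (of_nat m + of_nat n + 2 + of_nat i) l"
  proof -
    have "- of_nat (2 * m) - of_nat n - 1 = (- (of_nat (2 * m) + of_nat n + 1) :: complex)"
      "of_nat (2 * m) + of_nat n + 1 - of_nat l + 1 = (of_nat m + of_nat n + 2 + of_nat i :: complex)"
      by (simp_all add: m)
    then show ?thesis by (simp only: pochhammer_minus)
  qed
  finally have eq: "(\<Sum>k = 0..m. ?d k) = pochhammer (- of_nat m) i * pochhammer (of_nat n + 1) i * ((-1) ^ i / fact i)
      * ((-1) ^ l * pochhammer (of_nat m + of_nat n + 2 + of_nat i) l)
      / ((-1) ^ m * pochhammer (of_nat m + 1) m)" .
  have sgn: "(-1 :: complex) ^ m = (-1) ^ i * (-1) ^ l" by (simp add: m power_add)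
  have pp: "pochhammer (of_nat m + of_nat n + 2 :: complex) m
      = pochhammer (of_nat m + of_nat n + 2) i * pochhammer (of_nat m + of_nat n + 2 + of_nat i) l"
    using pochhammer_product'[of "of_nat m + of_nat n + 2 :: complex" i l] by (simp add: m)
  have nz1: "pochhammer (of_nat m + 1 :: complex) m \<noteq> 0" by (simp add: pochhammer_of_nat_Suc)
  have "of_nat m + of_nat n + 2 = (of_nat (m + n + 1) + 1 :: complex)" by simp
  then have "pochhammer (of_nat m + of_nat n + 2 :: complex) m \<noteq> 0"
    by (simp only: pochhammer_of_nat_Suc divide_eq_0_iff fact_nonzero) simp
  then show ?thesis
    using nz1 unfolding eq sgn pp by simp
qed

text \<open>Splitting \<open>pochhammer (1/2) (j + k + 1)\<close> after \<open>j\<close> or after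
  \<open>k + 1\<close> factors cancels \<open>pochhammer (1/2) j\<close> and changes the lower
  parameter from \<open>1/2\<close> to \<open>k + 3/2\<close>. The sum is then of Chu-Vandermonde
  type with upper parameters \<open>-n\<close> and \<open>1/2 - n\<close>.\<close>

lemma inner_sum:
  fixes n k :: nat
  shows "(\<Sum>j = 0..n. pochhammer (- of_nat n) j * pochhammer (1 / 2 - of_nat n) j
      / (fact j * pochhammer (1 / 2) j) * (fact k / pochhammer (of_nat j + 1 / 2) (k + 1)))
    = (fact k * pochhammer (of_nat n + 1 + of_nat k) n / pochhammer (1 / 2) (n + 1 + k) :: complex)"
    (is "(\<Sum>j = 0..n. ?f j) = _")
proof -
  have eq: "?f j = fact k / pochhammer (1 / 2) (k + 1)
      * (pochhammer (1 / 2 - of_nat n) j * pochhammer (- of_nat n) j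
        / (of_nat (fact j) * pochhammer (of_nat k + 3 / 2) j))" for j
  proof -
    have "pochhammer (1 / 2 :: complex) j * pochhammer (of_nat j + 1 / 2) (k + 1)
        = pochhammer (1 / 2) (k + 1) * pochhammer (of_nat k + 3 / 2) j"
      using pochhammer_product'[of "1 / 2 :: complex" j "k + 1"]
        pochhammer_product'[of "1 / 2 :: complex" "k + 1" j]
      by (simp add: algebra_simps del: pochhammer_Suc)
    then have "pochhammer (of_nat j + 1 / 2 :: complex) (k + 1)
        = pochhammer (1 / 2) (k + 1) * pochhammer (of_nat k + 3 / 2) j / pochhammer (1 / 2) j"
      by (simp add: field_simps pochhammer_add_half_nonzero)
    then show ?thesis
      by (simp add: pochhammer_add_half_nonzero mult_ac)
  qed
  have "of_nat k + 3 / 2 \<noteq> (- of_nat j :: complex)" for j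
    using pochhammer_add_half_nonzero(2)[of k "Suc j"]
    by (auto simp: pochhammer_Suc eq_neg_iff_add_eq_0)
  then have "(\<Sum>j = 0..n. ?f j) = fact k / pochhammer (1 / 2) (k + 1)
      * (pochhammer (of_nat k + 3 / 2 - (1 / 2 - of_nat n)) n / pochhammer (of_nat k + 3 / 2) n)"
    unfolding eq sum_distrib_left[symmetric]
    by (subst Vandermonde_pochhammer) auto
  also have "of_nat k + 3 / 2 - (1 / 2 - of_nat n) = (of_nat n + 1 + of_nat k :: complex)"
    by simp
  also have "pochhammer (1 / 2 :: complex) (n + 1 + k)
      = pochhammer (1 / 2) (k + 1) * pochhammer (of_nat k + 3 / 2) n"
    using pochhammer_product'[of "1 / 2 :: complex" "k + 1" n]
    by (simp add: algebra_simps del: pochhammer_Suc)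
  ultimately show ?thesis by simp
qed

section \<open>Watson's sum by contiguity relations and telescoping\<close>

text \<open>The summand of \<open>3F2(-m, 2x+1, 1; -2m, x+3/2; 1)\<close>: the upper parameter 1
  contributes \<open>fact k\<close>, which cancels the factorial in the denominator. The theorem
  uses \<open>x = n\<close>.\<close>

definition watson_term :: "nat \<Rightarrow> complex \<Rightarrow> nat \<Rightarrow> complex" where
  "watson_term m x k = pochhammer (- of_nat m) k * pochhammer (2 * x + 1) k
     / (pochhammer (- of_nat (2 * m)) k * pochhammer (x + 3 / 2) k)"

text \<open>Everything comes from the absorption rule
  \<open>(r - k) * pochhammer (-r) k = r * pochhammer (1 - r) k\<close>, applied once to the upper
  parameter \<open>-m\<close> and twice to the lower one, which moves by two; \<open>B1\<close> is
  the intermediate stage.\<close>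

lemma watson_term_Suc_left:
  assumes "k \<le> m"
  shows "watson_term (Suc m) x k * (2 * (2 * of_nat m + 1) * (of_nat m + 1 - of_nat k))
    = watson_term m x k * ((2 * of_nat m + 2 - of_nat k) * (2 * of_nat m + 1 - of_nat k))"
proof -
  define A0 A1 B0 B1 B2 :: complex where "A0 = pochhammer (- of_nat m) k"
    and "A1 = pochhammer (- of_nat (Suc m)) k" and "B0 = pochhammer (- of_nat (2 * m)) k"
    and "B1 = pochhammer (- of_nat (Suc (2 * m))) k"
    and "B2 = pochhammer (- of_nat (2 * Suc m)) k"
  have nz: "B0 \<noteq> 0" "B2 \<noteq> 0"
    using assms unfolding B0_def B2_def by (simp_all only: pochhammer_of_nat_eq_0_iff) auto
  have 1: "(of_nat m + 1 - of_nat k) * A1 = (of_nat m + 1) * A0"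
    using pochhammer_absorb_comp[of "of_nat (Suc m) :: complex" k] by (simp add: A0_def A1_def add.commute)
  have 2: "(2 * of_nat m + 2 - of_nat k) * B2 = (2 * of_nat m + 2) * B1"
    using pochhammer_absorb_comp[of "of_nat (2 * Suc m) :: complex" k]
    by (simp add: B1_def B2_def algebra_simps)
  have 3: "(2 * of_nat m + 1 - of_nat k) * B1 = (2 * of_nat m + 1) * B0"
    using pochhammer_absorb_comp[of "of_nat (Suc (2 * m)) :: complex" k]
    by (simp add: B0_def B1_def algebra_simps)
  have "A1 * (2 * (2 * of_nat m + 1) * (of_nat m + 1 - of_nat k)) * B0
      = 2 * ((of_nat m + 1 - of_nat k) * A1) * ((2 * of_nat m + 1) * B0)"
    by (simp only: mult_ac)
  also have "\<dots> = A0 * (2 * of_nat m + 1 - of_nat k) * ((2 * of_nat m + 2) * B1)"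
    unfolding 1 3[symmetric] by (simp add: algebra_simps)
  also have "\<dots> = A0 * ((2 * of_nat m + 2 - of_nat k) * (2 * of_nat m + 1 - of_nat k)) * B2"
    unfolding 2[symmetric] by (simp only: mult_ac)
  finally have "A1 / B2 * (2 * (2 * of_nat m + 1) * (of_nat m + 1 - of_nat k))
      = A0 / B0 * ((2 * of_nat m + 2 - of_nat k) * (2 * of_nat m + 1 - of_nat k))"
    by (simp only: times_divide_eq_left frac_eq_eq[OF nz(2) nz(1)])
  then have "A1 / B2 * (2 * (2 * of_nat m + 1) * (of_nat m + 1 - of_nat k))
        * (pochhammer (2 * x + 1) k / pochhammer (x + 3 / 2) k)
      = A0 / B0 * ((2 * of_nat m + 2 - of_nat k) * (2 * of_nat m + 1 - of_nat k))
        * (pochhammer (2 * x + 1) k / pochhammer (x + 3 / 2) k)"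
    by (simp only:)
  then show ?thesis
    unfolding watson_term_def A0_def[symmetric] A1_def[symmetric] B0_def[symmetric] B2_def[symmetric]
    by (simp only: times_divide_eq_left times_divide_eq_right divide_divide_eq_left mult_ac)
qed

lemma watson_term_Suc_right:
  assumes "k < m" "pochhammer (x + 3 / 2) (Suc k) \<noteq> 0"
  shows "watson_term m x (Suc k) * ((2 * of_nat m - of_nat k) * (x + 3 / 2 + of_nat k))
    = watson_term m x k * ((of_nat m - of_nat k) * (2 * x + 1 + of_nat k))"
proof -
  have "(2 * of_nat m - of_nat k :: complex) = of_nat (2 * m - k)" using assms by (simp add: of_nat_diff)
  also have "\<dots> \<noteq> 0" using assms by (simp del: of_nat_mult)
  finally have "(of_nat k - 2 * of_nat m :: complex) \<noteq> 0" by auto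
  moreover have "pochhammer (- of_nat (2 * m) :: complex) k \<noteq> 0"
    using assms by (simp add: pochhammer_neg_of_nat del: of_nat_mult)
  ultimately show ?thesis
    using assms(2) by (simp add: watson_term_def pochhammer_Suc divide_simps) algebra
qed

text \<open>The right-hand side is the Wilf-Zeilberger certificate, written so that it has no pole at
  \<open>k = m\<close>.\<close>

lemma watson_telescope:
  assumes x: "\<And>i. x + 3 / 2 + of_nat i \<noteq> 0" and "k \<le> m"
  shows "(\<Sum>i = 0..k. (of_nat m + x + 3 / 2) * (of_nat m + 1 / 2) * watson_term (Suc m) x i
      - (of_nat m + 1) * (of_nat m + x + 1) * watson_term m x i)
    = - (watson_term m x k * (2 * x + 1 + of_nat k) * (of_nat k + 1) / 4)"
  using \<open>k \<le> m\<close>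
proof (induction k)
  case 0
  then show ?case by (simp add: watson_term_def field_simps)
next
  case (Suc k)
  let ?M = "of_nat m :: complex" and ?K = "of_nat k :: complex"
  define T where "T = watson_term m x (Suc k)"
  have "pochhammer (x + 3 / 2) (Suc k) \<noteq> 0"
    using x unfolding pochhammer_eq_0_iff by (metis add.commute add_eq_0_iff)
  with Suc.prems have 1: "watson_term m x k * ((?M - ?K) * (2 * x + 1 + ?K))
      = T * ((2 * ?M - ?K) * (x + 3 / 2 + ?K))"
    unfolding T_def by (subst watson_term_Suc_right) auto
  have 2: "watson_term (Suc m) x (Suc k) * (2 * (2 * ?M + 1) * (?M - ?K))
      = T * ((2 * ?M + 1 - ?K) * (2 * ?M - ?K))"
    using watson_term_Suc_left[OF Suc.prems, of x] by (simp add: T_def algebra_simps)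
  have M: "?M - ?K \<noteq> 0" using Suc.prems by simp
  have IH: "(\<Sum>i = 0..k. (?M + x + 3 / 2) * (?M + 1 / 2) * watson_term (Suc m) x i
      - (?M + 1) * (?M + x + 1) * watson_term m x i)
    = - (watson_term m x k * (2 * x + 1 + ?K) * (?K + 1) / 4)"
    using Suc by simp
  define U V where "U = watson_term (Suc m) x (Suc k)" and "V = watson_term m x k"
  \<comment> \<open>After multiplication by \<open>?M - ?K\<close>, which is nonzero since
    \<open>k < m\<close>, relations 1 and 2 eliminate \<open>V\<close> and \<open>U\<close> in
    favour of \<open>T\<close>; a polynomial identity remains.\<close>
  have "(?M - ?K) * (- (V * (2 * x + 1 + ?K) * (?K + 1) / 4)
      + ((?M + x + 3 / 2) * (?M + 1 / 2) * U - (?M + 1) * (?M + x + 1) * T))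
    = (?M - ?K) * - (T * (2 * x + 1 + (?K + 1)) * (?K + 1 + 1) / 4)"
  proof -
    have "(?M - ?K) * (- (V * (2 * x + 1 + ?K) * (?K + 1) / 4)
      + ((?M + x + 3 / 2) * (?M + 1 / 2) * U - (?M + 1) * (?M + x + 1) * T))
      = - (V * ((?M - ?K) * (2 * x + 1 + ?K))) * (?K + 1) / 4
       + (?M + x + 3 / 2) / 4 * (U * (2 * (2 * ?M + 1) * (?M - ?K)))
       - (?M - ?K) * ((?M + 1) * (?M + x + 1) * T)"
      by (simp add: field_simps)
    also have "\<dots> = (?M - ?K) * - (T * (2 * x + 1 + (?K + 1)) * (?K + 1 + 1) / 4)"
      unfolding 1[folded V_def] 2[folded U_def] by (simp add: field_simps)
    finally show ?thesis .
  qed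
  then have "- (V * (2 * x + 1 + ?K) * (?K + 1) / 4)
      + ((?M + x + 3 / 2) * (?M + 1 / 2) * U - (?M + 1) * (?M + x + 1) * T)
    = - (T * (2 * x + 1 + (?K + 1)) * (?K + 1 + 1) / 4)"
    using M by (simp only: mult_cancel_left) simp
  then show ?case
    unfolding sum.atLeast0_atMost_Suc IH U_def V_def T_def by (simp add: add.commute)
qed

text \<open>The telescoped sum stops at \<open>k = m\<close>, while the series for
  \<open>Suc m\<close> has one more term. That top term cancels the boundary term exactly, so
  consecutive sums have ratio \<open>Q / P\<close>, which is also the ratio of the closed
  forms.\<close>

lemma watson_sum:
  assumes x: "\<And>i. x + 3 / 2 + of_nat i \<noteq> 0"
  shows "(\<Sum>k = 0..m. watson_term m x k)
    = fact m * pochhammer (x + 1) m / (pochhammer (1 / 2) m * pochhammer (x + 3 / 2) m)"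
proof (induction m)
  case 0
  then show ?case by (simp add: watson_term_def)
next
  case (Suc m)
  let ?M = "of_nat m :: complex"
  define P Q where "P = (?M + x + 3 / 2) * (?M + 1 / 2)" and "Q = (?M + 1) * (?M + x + 1)"
  define T where "T = watson_term m x m"
  have xm: "pochhammer (x + 3 / 2) k \<noteq> 0" for k
    using x unfolding pochhammer_eq_0_iff by (metis add.commute add_eq_0_iff)
  have h: "?M + 1 / 2 \<noteq> 0"
    using pochhammer_add_half_nonzero(1)[of m 1] by simp
  have P: "P \<noteq> 0" using x[of m] h by (simp add: P_def add_ac)
  \<comment> \<open>The top term is reached from \<open>T\<close> in two moves: raise
    \<open>m\<close> at \<open>k = m\<close> (relation 2), then raise \<open>k\<close> (relation 1).
    The common factor \<open>?M + 2\<close> is cancelled afterwards.\<close>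
  have 1: "watson_term (Suc m) x (Suc m) * ((?M + 2) * (x + 3 / 2 + ?M))
      = watson_term (Suc m) x m * (2 * x + 1 + ?M)"
    using watson_term_Suc_right[of m "Suc m" x, OF _ xm] by (simp add: algebra_simps)
  have 2: "watson_term (Suc m) x m * (2 * (2 * ?M + 1)) = T * ((?M + 2) * (?M + 1))"
    using watson_term_Suc_left[of m m x] by (simp add: T_def algebra_simps)
  have "?M + 2 = of_nat (m + 2)" by simp
  then have M2: "?M + 2 \<noteq> 0" by (metis of_nat_eq_0_iff add_is_0 zero_neq_numeral)
  have "(?M + 2) * (4 * (P * watson_term (Suc m) x (Suc m)))
      = (?M + 2) * (T * (2 * x + 1 + ?M) * (?M + 1))"
  proof -
    have "(?M + 2) * (4 * (P * watson_term (Suc m) x (Suc m)))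
      = watson_term (Suc m) x (Suc m) * ((?M + 2) * (x + 3 / 2 + ?M)) * (2 * (2 * ?M + 1))"
      by (simp add: P_def field_simps)
    also have "\<dots> = (?M + 2) * (T * (2 * x + 1 + ?M) * (?M + 1))"
      unfolding 1 using 2 by algebra
    finally show ?thesis .
  qed
  then have 3: "P * watson_term (Suc m) x (Suc m) = T * (2 * x + 1 + ?M) * (?M + 1) / 4"
    using M2 by (simp only: mult_cancel_left) (simp add: field_simps)
  have "P * (\<Sum>k = 0..m. watson_term (Suc m) x k) - Q * (\<Sum>k = 0..m. watson_term m x k)
      = - (T * (2 * x + 1 + ?M) * (?M + 1) / 4)"
    using watson_telescope[of x m m, OF x]
    unfolding P_def[symmetric] Q_def[symmetric] T_def[symmetric]
    by (simp add: sum_distrib_left sum_subtractf)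
  then have "P * (\<Sum>k = 0..Suc m. watson_term (Suc m) x k) = Q * (\<Sum>k = 0..m. watson_term m x k)"
    unfolding sum.atLeast0_atMost_Suc distrib_left 3 by (simp add: diff_eq_eq)
  then have "(\<Sum>k = 0..Suc m. watson_term (Suc m) x k) = Q * (\<Sum>k = 0..m. watson_term m x k) / P"
    using P by (simp add: field_simps)
  then show ?case
    unfolding Suc.IH by (simp add: P_def Q_def pochhammer_Suc algebra_simps)
qed

section \<open>Interchange of the sums and conversion to factorials\<close>

theorem proposition2:
  fixes m n :: nat
  shows "S m n =
    2 ^ (2 * m + 2 * n)
      * (fact m * fact (m + n) * fact (m + n + 1) * pochhammer (1 / 2) n
         / (fact n * fact (n + 2 * m + 1) * pochhammer (1 / 2) (m + n + 1)))"
proof -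
  \<comment> \<open>\<open>K\<close> is the value at 1 of the polynomial
    \<open>2F1(-m, n+1; m+n+2; x)\<close>, and \<open>K * d k\<close> is its coefficient at
    \<open>(1-x)^k\<close>. Opaque names keep the interchange of sums purely formal.\<close>
  define K :: complex where "K = pochhammer (of_nat m + 1) m / pochhammer (of_nat m + of_nat n + 2) m"
  define d :: "nat \<Rightarrow> complex" where "d k = pochhammer (- of_nat m) k * pochhammer (of_nat n + 1) k
          / (fact k * pochhammer (- of_nat (2 * m)) k)" for k
  define e :: "nat \<Rightarrow> complex" where "e j = pochhammer (- of_nat n) j * pochhammer (1 / 2 - of_nat n) j
            / (fact j * pochhammer (1 / 2) j)" for j
  define g :: "nat \<Rightarrow> nat \<Rightarrow> complex" where "g k i = pochhammer (- of_nat k) i / fact i" for k i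
  define r :: "nat \<Rightarrow> nat \<Rightarrow> complex" where "r i j = 1 / (of_nat i + of_nat j + 1 / 2)" for i j
  have half: "(of_nat j + 1 / 2 :: complex) + of_nat i \<noteq> 0" for i j
    using pochhammer_add_half_nonzero(1)[of j "Suc i"] by (auto simp: pochhammer_Suc)
  have three_half: "(of_nat j + 3 / 2 :: complex) + of_nat i \<noteq> 0" for i j
    using pochhammer_add_half_nonzero(2)[of j "Suc i"] by (auto simp: pochhammer_Suc)
  have "S m n = (\<Sum>i = 0..m. K * (\<Sum>k = 0..m. d k * g k i) * (\<Sum>j = 0..n. e j * r i j))"
    unfolding S_def K_def d_def e_def g_def r_def
    by (rule sum.cong[OF refl], subst outer_coeff_expansion) (simp_all only: atLeastAtMost_iff)
  also have "\<dots> = K * (\<Sum>i = 0..m. \<Sum>k = 0..m. \<Sum>j = 0..n. d k * g k i * (e j * r i j))"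
    by (simp only: mult.assoc sum_product) (rule sum_distrib_left[symmetric])
  \<comment> \<open>The sum over \<open>i\<close> is moved innermost, where it is a partial fraction
    sum with \<open>z = j + 1/2\<close>.\<close>
  also have "(\<Sum>i = 0..m. \<Sum>k = 0..m. \<Sum>j = 0..n. d k * g k i * (e j * r i j))
      = (\<Sum>k = 0..m. \<Sum>i = 0..m. \<Sum>j = 0..n. d k * g k i * (e j * r i j))"
    by (rule sum.swap)
  also have "\<dots> = (\<Sum>k = 0..m. \<Sum>j = 0..n. \<Sum>i = 0..m. d k * g k i * (e j * r i j))"
    by (rule sum.cong[OF refl], rule sum.swap)
  also have "\<dots> = (\<Sum>k = 0..m. d k * (\<Sum>j = 0..n. e j * (\<Sum>i = 0..m. g k i * r i j)))"
    by (simp only: sum_distrib_left mult_ac)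
  also have "\<dots> = (\<Sum>k = 0..m. d k * (\<Sum>j = 0..n. e j * (fact k / pochhammer (of_nat j + 1 / 2) (k + 1))))"
  proof (intro sum.cong refl arg_cong2[where f = "(*)"])
    fix k j assume "k \<in> {0..m}"
    then show "(\<Sum>i = 0..m. g k i * r i j) = fact k / pochhammer (of_nat j + 1 / 2) (k + 1)"
      using partial_fraction_pochhammer[of "of_nat j + 1 / 2 :: complex" k m, OF half]
      by (simp add: g_def r_def add_ac)
  qed
  also have "\<dots> = (\<Sum>k = 0..m. d k * (fact k * pochhammer (of_nat n + 1 + of_nat k) n
      / pochhammer (1 / 2) (n + 1 + k)))"
    unfolding e_def inner_sum ..
  also have "\<dots> = (\<Sum>k = 0..m. pochhammer (of_nat n + 1) n / pochhammer (1 / 2) (n + 1)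
      * watson_term m (of_nat n) k)"
  proof (intro sum.cong refl)
    fix k
    \<comment> \<open>Both sides are \<open>pochhammer (n + 1) (n + k)\<close>, split after
      \<open>k\<close> and after \<open>n\<close> factors.\<close>
    have 1: "pochhammer (of_nat n + 1 :: complex) k * pochhammer (of_nat n + 1 + of_nat k) n
        = pochhammer (of_nat n + 1) n * pochhammer (2 * of_nat n + 1) k"
      using pochhammer_product'[of "of_nat n + 1 :: complex" k n]
        pochhammer_product'[of "of_nat n + 1 :: complex" n k]
      by (simp add: add_ac flip: mult_2)
    have 2: "pochhammer (1 / 2 :: complex) (n + 1 + k)
        = pochhammer (1 / 2) (n + 1) * pochhammer (of_nat n + 3 / 2) k"
      using pochhammer_product'[of "1 / 2 :: complex" "n + 1" k]
      by (simp add: add_ac del: pochhammer_Suc)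
    have "d k * (fact k * pochhammer (of_nat n + 1 + of_nat k) n / pochhammer (1 / 2) (n + 1 + k))
      = pochhammer (- of_nat m) k
        * (pochhammer (of_nat n + 1 :: complex) k * pochhammer (of_nat n + 1 + of_nat k) n)
        / (pochhammer (- of_nat (2 * m)) k * pochhammer (1 / 2 :: complex) (n + 1 + k))"
      by (simp add: d_def)
    then show "d k * (fact k * pochhammer (of_nat n + 1 + of_nat k) n / pochhammer (1 / 2) (n + 1 + k))
      = pochhammer (of_nat n + 1) n / pochhammer (1 / 2) (n + 1) * watson_term m (of_nat n) k"
      unfolding 1 2 by (simp add: watson_term_def mult_ac)
  qed
  also have "\<dots> = pochhammer (of_nat n + 1) n / pochhammer (1 / 2) (n + 1)
      * (fact m * pochhammer (of_nat n + 1) m / (pochhammer (1 / 2) m * pochhammer (of_nat n + 3 / 2) m))"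
    unfolding sum_distrib_left[symmetric] watson_sum[OF three_half] ..
  finally have S: "S m n = K * (pochhammer (of_nat n + 1) n * fact m * pochhammer (of_nat n + 1) m
      / (pochhammer (1 / 2) m * (pochhammer (1 / 2) (n + 1) * pochhammer (of_nat n + 3 / 2) m)))"
    by (simp add: mult_ac)
  have 1: "pochhammer (1 / 2 :: complex) (n + 1) * pochhammer (of_nat n + 3 / 2) m
      = pochhammer (1 / 2) (m + n + 1)"
    using pochhammer_product'[of "1 / 2 :: complex" "n + 1" m]
    by (simp add: add_ac)
  have 2: "pochhammer (of_nat m + of_nat n + 2 :: complex) m = fact (n + 2 * m + 1) / fact (m + n + 1)"
  proof -
    have "of_nat m + of_nat n + 2 = (of_nat (m + n + 1) + 1 :: complex)" "n + 2 * m + 1 = m + n + 1 + m"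
      by simp_all
    then show ?thesis by (simp only: pochhammer_of_nat_Suc)
  qed
  \<comment> \<open>Duplication formula for \<open>(2k)! / k!\<close>. It is used for
    \<open>k = m\<close> (inside \<open>K\<close>) and for \<open>k = n\<close>, which together give
    the power of 2; at \<open>k = m\<close> the factor \<open>pochhammer (1/2) m\<close> cancels the
    one from Watson's sum.\<close>
  have 3: "pochhammer (of_nat k + 1 :: complex) k = 2 ^ (2 * k) * pochhammer (1 / 2) k" for k
    unfolding pochhammer_of_nat_Suc mult_2[symmetric] fact_double by simp
  have 4: "pochhammer (of_nat n + 1 :: complex) m = fact (m + n) / fact n"
    by (simp add: pochhammer_of_nat_Suc add.commute[of m n])
  show ?thesis
    unfolding S K_def 1 2 3 4
    by (simp add: pochhammer_add_half_nonzero(3) power_add mult_ac del: fact_Suc)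
qed

end
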